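(* Let $\{C_t\}_{t\in\mathbb{N}}$ be a sequence of closed coverings of $M$, each of which is obtained by subdividing the previous one, whose diameters $d_t$ tend to zero, and let $G_t$ be the symbolic image of $f$ with respect to $C_t$. Suppose that on each $G_t$ an admissible path $\omega_t=\{i_k^t,\ k\in\mathbb{Z}\}$ is given such that the sequence of paths $\{\omega_t\}$ is consistent. Then: 1. There exists a unique trajectory $T=\{x_k : x_{k+1}=f(x_k),\ k\in\mathbb{Z}\}$ such that $x_k\in M_t(i_k^t)$ for all $t$ and all $k$. 2. If points $x_k^t$ lie in the cells $M_t(i_k^t)$, then for each $k$ the limit $\lim_{t\to\infty}x_k^t$ exists and coincides with $x_k$. 3. If each path $\omega_t$ is periodic, then the trajectory $T$ is recurrent.
   Context: $M$ is a compact Riemannian manifold with distance $\rho$, and $f\colon M\to M$ is a homeomorphism. A trajectory is a doubly infinite sequence $\{x_k\}_{k\in\mathbb{Z}}$ in $M$ with $f(x_k)=x_{k+1}$ for all $k$. A covering $C$ is a finite covering of $M$ by closed (nonempty) sets $M(i)$ called cells; cells are taken to be polyhedral (as in a triangulation of $M$), distinct cells intersecting in boundary discs. The diameter of $C$ is the greatest of the diameters of its cells. The symbolic image of $f$ for $C=\{M(1),\dots,M(n)\}$ is the directed graph $G$ with vertices $i=1,\dots,n$ and an arc $i\to j$ if and only if $f(M(i))\cap M(j)\neq\varnothing$. An (admissible) path on $G$ is a doubly infinite sequence $\{z_k\}_{k\in\mathbb{Z}}$ of vertices such that $z_k\to z_{k+1}$ is an arc for each $k$; it is periodic if for some $p\ge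 1$ one has $z_{k+p}=z_k$ for all $k$. The cells of $C_t$ are denoted $M_t(i)$. That $C_{t+1}$ is obtained by subdividing $C_t$ means that each cell $M_t(i)$ is subdivided into cells $m(i,k)$, $k=1,2,\dots$ (finitely many), with $\bigcup_k m(i,k)=M_t(i)$, and $C_{t+1}=\{m(i,k)\}$. The vertices of $G_{t+1}$ are then the pairs $(i,k)$, and $s(i,k)=i$ defines a map $s$ of directed graphs $G_{t+1}\to G_t$ (arcs are sent to arcs); applied termwise it sends paths on $G_{t+1}$ to paths on $G_t$. A sequence of paths $\omega_t$ on $G_t$ is consistent if $\omega_t=s(\omega_{t+1})$ for each $t$. A trajectory $K$ is recurrent (in the sense of Birkhoff) if for each $\varepsilon>0$ there is a positive integer $p$ such that any interval of length $p$ of this trajectory approximates the whole trajectory with accuracy $\varepsilon$, i.e. the $\varepsilon$-neighbourhood of any $p$ consecutive points of $K$ contains all of $K$. *)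

theory Defs
  imports "HOL-Analysis.Analysis" "Graph_Theory.Pair_Digraph"
begin

fun Ck_on :: "nat \<Rightarrow> ('e::euclidean_space \<Rightarrow> 'b::real_normed_vector) \<Rightarrow> 'e set \<Rightarrow> bool" where
  "Ck_on 0 h S \<longleftrightarrow> continuous_on S h"
| "Ck_on (Suc n) h S \<longleftrightarrow> (\<forall>y\<in>S. h differentiable (at y)) \<and>
     (\<forall>v. Ck_on n (\<lambda>y. frechet_derivative h (at y) v) S)"

text \<open>\<open>Ck_on\<close> and \<open>smooth_on\<close> are only meant for open \<open>S\<close>.\<close>

definition smooth_on :: "('e::euclidean_space \<Rightarrow> 'b::real_normed_vector) \<Rightarrow> 'e set \<Rightarrow> bool" where
  "smooth_on h S \<longleftrightarrow> (\<forall>n. Ck_on n h S)"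

type_synonym ('a, 'e) chart = "'a set \<times> ('a \<Rightarrow> 'e)"

abbreviation chart_dom :: "('a, 'e) chart \<Rightarrow> 'a set" where "chart_dom \<equiv> fst"
abbreviation chart_map :: "('a, 'e) chart \<Rightarrow> 'a \<Rightarrow> 'e" where "chart_map \<equiv> snd"

definition chart_inv :: "('a, 'e) chart \<Rightarrow> 'e \<Rightarrow> 'a" where
  "chart_inv c = inv_into (chart_dom c) (chart_map c)"

definition transition :: "('a, 'e) chart \<Rightarrow> ('a, 'e) chart \<Rightarrow> 'e \<Rightarrow> 'e" where
  "transition c c' = chart_map c' \<circ> chart_inv c"

definition smooth_atlas ::
  "'a::topological_space set \<Rightarrow> ('a, 'e::euclidean_space) chart set \<Rightarrow> bool" where
  "smooth_atlas M A \<longleftrightarrow>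
     (\<Union>c\<in>A. chart_dom c) = M \<and>
     (\<forall>c\<in>A. openin (top_of_set M) (chart_dom c) \<and>
            open (chart_map c ` chart_dom c) \<and>
            homeomorphism (chart_dom c) (chart_map c ` chart_dom c) (chart_map c) (chart_inv c)) \<and>
     (\<forall>c\<in>A. \<forall>c'\<in>A. smooth_on (transition c c') (chart_map c ` (chart_dom c \<inter> chart_dom c')))"

text \<open>
  \<open>g c y v w\<close> is the value at the point with \<open>c\<close>-coordinates \<open>y\<close> of the metric tensor on the
  tangent vectors with \<open>c\<close>-coordinates \<open>v\<close> and \<open>w\<close>.
\<close>

type_synonym ('a, 'e) metric_tensor = "('a, 'e) chart \<Rightarrow> 'e \<Rightarrow> 'e \<Rightarrow> 'e \<Rightarrow> real"

definition riemannian_metric ::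
  "('a, 'e::euclidean_space) chart set \<Rightarrow> ('a, 'e) metric_tensor \<Rightarrow> bool" where
  "riemannian_metric A g \<longleftrightarrow>
     (\<forall>c\<in>A. \<forall>y\<in>chart_map c ` chart_dom c.
        bilinear (g c y) \<and> (\<forall>v w. g c y v w = g c y w v) \<and> (\<forall>v. v \<noteq> 0 \<longrightarrow> g c y v v > 0)) \<and>
     (\<forall>c\<in>A. \<forall>v w. smooth_on (\<lambda>y. g c y v w) (chart_map c ` chart_dom c)) \<and>
     (\<forall>c\<in>A. \<forall>c'\<in>A. \<forall>y\<in>chart_map c ` (chart_dom c \<inter> chart_dom c'). \<forall>v w.
        g c y v w = g c' (transition c c' y)
                      (frechet_derivative (transition c c') (at y) v)
                      (frechet_derivative (transition c c') (at y) w))"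

definition C1_curve_on ::
  "('a::topological_space, 'e::euclidean_space) chart set \<Rightarrow> real set \<Rightarrow> (real \<Rightarrow> 'a) \<Rightarrow> bool" where
  "C1_curve_on A I \<gamma> \<longleftrightarrow> continuous_on I \<gamma> \<and>
     (\<forall>c\<in>A. \<exists>v. continuous_on {s\<in>I. \<gamma> s \<in> chart_dom c} v \<and>
        (\<forall>s\<in>I. \<gamma> s \<in> chart_dom c \<longrightarrow>
           ((chart_map c \<circ> \<gamma>) has_vector_derivative v s) (at s within I)))"

definition piecewise_C1_curves ::
  "'a::topological_space set \<Rightarrow> ('a, 'e::euclidean_space) chart set \<Rightarrow> 'a \<Rightarrow> 'a \<Rightarrow> (real \<Rightarrow> 'a) set" where
  "piecewise_C1_curves M A x y = {\<gamma>.
     \<gamma> ` {0..1} \<subseteq> M \<and> \<gamma> 0 = x \<and> \<gamma> 1 = y \<and> continuous_on {0..1} \<gamma> \<and>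
     (\<exists>B. finite B \<and> (\<forall>a b. 0 \<le> a \<and> a < b \<and> b \<le> 1 \<and> {a<..<b} \<inter> B = {} \<longrightarrow> C1_curve_on A {a..b} \<gamma>))}"

text \<open>
  The choice of a chart in \<open>speed\<close> is immaterial for a Riemannian metric; at the finitely many
  break points of a piecewise \<open>C1\<close> curve the value is arbitrary and does not affect the length.
\<close>

definition speed ::
  "('a, 'e::euclidean_space) chart set \<Rightarrow> ('a, 'e) metric_tensor \<Rightarrow> (real \<Rightarrow> 'a) \<Rightarrow> real \<Rightarrow> real" where
  "speed A g \<gamma> s =
     (let c = (SOME c. c \<in> A \<and> \<gamma> s \<in> chart_dom c);
          v = vector_derivative (chart_map c \<circ> \<gamma>) (at s within {0..1})
      in sqrt (g c (chart_map c (\<gamma> s)) v v))"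

definition curve_length ::
  "('a, 'e::euclidean_space) chart set \<Rightarrow> ('a, 'e) metric_tensor \<Rightarrow> (real \<Rightarrow> 'a) \<Rightarrow> real" where
  "curve_length A g \<gamma> = integral {0..1} (speed A g \<gamma>)"

text \<open>
  The Riemannian distance is \<open>dist\<close> restricted to \<open>M\<close>. Connectedness of \<open>M\<close> is not required: points
  that cannot be joined by a curve may have any distance compatible with the topology.
\<close>

definition compact_riemannian_manifold ::
  "'a::metric_space set \<Rightarrow> ('a, 'e::euclidean_space) chart set \<Rightarrow> ('a, 'e) metric_tensor \<Rightarrow> bool" where
  "compact_riemannian_manifold M A g \<longleftrightarrow>
     compact M \<and> smooth_atlas M A \<and> riemannian_metric A g \<and>
     (\<forall>x\<in>M. \<forall>y\<in>M. piecewise_C1_curves M A x y \<noteq> {} \<longrightarrow>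
        dist x y = (INF \<gamma>\<in>piecewise_C1_curves M A x y. curve_length A g \<gamma>))"

text \<open>
  The type argument carries the model space \<open>'e\<close> of the manifold and thereby its dimension.
  A polyhedral set is a finite union of topological simplices of full dimension.
\<close>

definition polyhedral :: "'e::euclidean_space itself \<Rightarrow> 'a::topological_space set \<Rightarrow> bool" where
  "polyhedral E S \<longleftrightarrow> (\<exists>F. finite F \<and> S = \<Union>F \<and>
     (\<forall>Q\<in>F. \<exists>\<Delta> :: 'e set. int DIM('e) simplex \<Delta> \<and> Q homeomorphic \<Delta>))"

text \<open>A closed disc of some dimension \<open>0, \<dots>, DIM('e) - 1\<close>: the unit ball of a proper subspace.\<close>

definition lower_disc :: "'e::euclidean_space itself \<Rightarrow> 'a::topological_space set \<Rightarrow> bool" where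
  "lower_disc E D \<longleftrightarrow> (\<exists>W :: 'e set. subspace W \<and> dim W < DIM('e) \<and> D homeomorphic (cball 0 1 \<inter> W))"

text \<open>
  Two cells may meet in no disc or in several ones, as two arcs covering a circle do.
\<close>

definition covering ::
  "'e::euclidean_space itself \<Rightarrow> 'a::metric_space set \<Rightarrow> 'v set \<Rightarrow> ('v \<Rightarrow> 'a set) \<Rightarrow> bool" where
  "covering E M V cell \<longleftrightarrow>
     finite V \<and> (\<Union>i\<in>V. cell i) = M \<and>
     (\<forall>i\<in>V. closed (cell i) \<and> cell i \<noteq> {} \<and> polyhedral E (cell i)) \<and>
     (\<forall>i\<in>V. \<forall>j\<in>V. i \<noteq> j \<longrightarrow>
        cell i \<inter> cell j \<subseteq> (top_of_set M) frontier_of cell i \<inter> (top_of_set M) frontier_of cell j \<and>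
        (\<exists>F. finite F \<and> cell i \<inter> cell j = \<Union>F \<and> (\<forall>D\<in>F. lower_disc E D)))"

definition covering_diameter :: "'v set \<Rightarrow> ('v \<Rightarrow> 'a::metric_space set) \<Rightarrow> real" where
  "covering_diameter V cell = (MAX i\<in>V. diameter (cell i))"

text \<open>
  The cells \<open>m(i,k)\<close> of a subdivision are labelled by arbitrary labels \<open>j\<close> with parent \<open>s j = i\<close>.
\<close>

definition subdivides ::
  "('v \<Rightarrow> 'v) \<Rightarrow> 'v set \<Rightarrow> ('v \<Rightarrow> 'a set) \<Rightarrow> 'v set \<Rightarrow> ('v \<Rightarrow> 'a set) \<Rightarrow> bool" where
  "subdivides s V' cell' V cell \<longleftrightarrow>
     s \<in> V' \<rightarrow> V \<and> (\<forall>i\<in>V. (\<Union>j\<in>{j\<in>V'. s j = i}. cell' j) = cell i)"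

definition symbolic_image ::
  "('a \<Rightarrow> 'a) \<Rightarrow> 'v set \<Rightarrow> ('v \<Rightarrow> 'a set) \<Rightarrow> 'v pair_pre_digraph" where
  "symbolic_image f V cell =
     \<lparr>pverts = V, parcs = {(i, j). i \<in> V \<and> j \<in> V \<and> f ` cell i \<inter> cell j \<noteq> {}}\<rparr>"

definition admissible_path :: "'v pair_pre_digraph \<Rightarrow> (int \<Rightarrow> 'v) \<Rightarrow> bool" where
  "admissible_path G z \<longleftrightarrow> (\<forall>k. z k \<in> pverts G \<and> (z k, z (k + 1)) \<in> parcs G)"

definition periodic_path :: "(int \<Rightarrow> 'v) \<Rightarrow> bool" where
  "periodic_path z \<longleftrightarrow> (\<exists>p::nat. p \<ge> 1 \<and> (\<forall>k. z (k + int p) = z k))"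

definition consistent_paths :: "(nat \<Rightarrow> 'v \<Rightarrow> 'v) \<Rightarrow> (nat \<Rightarrow> int \<Rightarrow> 'v) \<Rightarrow> bool" where
  "consistent_paths s \<omega> \<longleftrightarrow> (\<forall>t. \<omega> t = s t \<circ> \<omega> (Suc t))"

definition trajectory :: "'a set \<Rightarrow> ('a \<Rightarrow> 'a) \<Rightarrow> (int \<Rightarrow> 'a) \<Rightarrow> bool" where
  "trajectory M f x \<longleftrightarrow> (\<forall>k. x k \<in> M \<and> f (x k) = x (k + 1))"

definition recurrent :: "(int \<Rightarrow> 'a::metric_space) \<Rightarrow> bool" where
  "recurrent x \<longleftrightarrow> (\<forall>\<epsilon>>0. \<exists>p::nat. p > 0 \<and>
     (\<forall>m. range x \<subseteq> (\<Union>k\<in>{m..<m + int p}. ball (x k) \<epsilon>)))"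

end

theory Submission
  imports Defs
begin

text \<open>
  Along a consistent sequence of paths the cells \<open>cell t (\<omega> t k)\<close>, for fixed \<open>k\<close>, form a nested
  sequence of compact sets whose diameters tend to zero, so they shrink to a single point \<open>x k\<close> and
  any choice of points in them converges to it. An arc of the symbolic image provides a point of
  one cell mapped into the next one, and in the limit this yields \<open>f (x k) = x (k + 1)\<close>. If
  \<open>\<omega> t\<close> has period \<open>p\<close>, every point of the trajectory shares a cell of \<open>C\<^sub>t\<close> with one of any
  \<open>p\<close> consecutive points.
\<close>

text \<open>Both \<open>y n\<close> and \<open>x\<close> lie in \<open>S n\<close>, so
  \<open>d n\<close> dominates their distance. Boundedness is what lets \<open>diameter\<close>
  bound distances.\<close>

lemma tendsto_of_mem_diameter_tendsto_zero:
  fixes S :: "nat \<Rightarrow> 'a::metric_space set"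
  assumes "\<And>n. bounded (S n)" and "\<And>n. y n \<in> S n" and "\<And>n. x \<in> S n"
    and "\<And>n. diameter (S n) \<le> d n" and "d \<longlonglongrightarrow> 0"
  shows "y \<longlonglongrightarrow> x"
proof -
  have "dist (y n) x \<le> dist (d n) 0" for n
    using diameter_bounded_bound[OF assms(1)[of n] assms(2)[of n] assms(3)[of n]] assms(4)[of n]
    unfolding dist_real_def by linarith
  then have "\<forall>\<^sub>F n in sequentially. dist (y n) x \<le> dist (d n) 0"
    by (rule always_eventually[OF allI])
  then show ?thesis
    by (rule metric_tendsto_imp_tendsto[OF assms(5)])
qed

lemma nested_compact_nonempty:
  fixes S :: "nat \<Rightarrow> 'a::t2_space set"
  assumes "\<And>n. compact (S n)" "\<And>n. S n \<noteq> {}" "\<And>m n. m \<le> n \<Longrightarrow> S n \<subseteq> S m"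
  obtains x where "\<And>n. x \<in> S n"
proof -
  have "S 0 \<inter> (\<Inter>n\<in>UNIV. S n) \<noteq> {}"
  proof (rule compact_imp_fip_image)
    fix I :: "nat set" assume I: "finite I"
    obtain m where m: "\<And>n. n \<in> I \<Longrightarrow> n \<le> m"
      using finite_nat_set_iff_bounded_le[of I] I by blast
    \<comment> \<open>By nesting, the set at an upper bound \<open>m\<close> of \<open>I\<close>
      lies in every member of the finite subfamily.\<close>
    have "S m \<subseteq> S 0 \<inter> (\<Inter>n\<in>I. S n)"
      using assms(3) m by blast
    then show "S 0 \<inter> (\<Inter>n\<in>I. S n) \<noteq> {}"
      using assms(2)[of m] by blast
  qed (use assms(1) compact_imp_closed in auto)
  then show thesis
    using that by blast
qed

lemma covering_cell_subset: "covering E M V cell \<Longrightarrow> i \<in> V \<Longrightarrow> cell i \<subseteq> M"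
  by (auto simp: covering_def)

lemma covering_cell_compact:
  assumes "covering E M V cell" "compact M" "i \<in> V"
  shows "compact (cell i)"
  using assms compact_Int_closed[of M "cell i"] covering_cell_subset[OF assms(1,3)]
  by (auto simp: covering_def Int_absorb1)

lemma diameter_le_covering_diameter:
  "covering E M V cell \<Longrightarrow> i \<in> V \<Longrightarrow> diameter (cell i) \<le> covering_diameter V cell"
  by (auto simp: covering_def covering_diameter_def)

lemma subdivides_cell_subset: "subdivides s V' cell' V cell \<Longrightarrow> j \<in> V' \<Longrightarrow> cell' j \<subseteq> cell (s j)"
  by (fastforce simp: subdivides_def)

lemma admissible_path_symbolic_image_arcE:
  assumes "admissible_path (symbolic_image f V cell) z"
  obtains a where "a \<in> cell (z k)" "f a \<in> cell (z (k + 1))"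
  using assms by (fastforce simp: admissible_path_def symbolic_image_def)

lemma periodic_path_shift:
  fixes z :: "int \<Rightarrow> 'v"
  assumes "\<And>k. z (k + p) = z k"
  shows "z (k + q * p) = z k"
proof (induction q rule: int_induct[where k = 0])
  case (step1 i)
  then show ?case using assms[of "k + i * p"] by (simp add: algebra_simps)
next
  case (step2 i)
  \<comment> \<open>For negative multiples the period equation is read backwards, from one period
    lower.\<close>
  then show ?case using assms[of "k + (i - 1) * p"] by (simp add: algebra_simps)
qed simp

text \<open>Any window of \<open>p\<close> consecutive indices meets every residue class modulo
  \<open>p\<close>, hence shows every label of a \<open>p\<close>-periodic \<open>z\<close>. The
  labelling may change with the accuracy.\<close>

lemma recurrent_if_periodic_cells:
  fixes x :: "int \<Rightarrow> 'a::metric_space"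
  assumes "\<And>\<epsilon>. \<epsilon> > 0 \<Longrightarrow> \<exists>z::int \<Rightarrow> 'v. periodic_path z \<and>
    (\<forall>j k. z j = z k \<longrightarrow> dist (x j) (x k) < \<epsilon>)"
  shows "recurrent x"
  unfolding recurrent_def
proof (intro allI impI)
  fix \<epsilon> :: real assume "\<epsilon> > 0"
  then obtain z :: "int \<Rightarrow> 'v" and p :: nat where p: "p \<ge> 1" "\<And>k. z (k + int p) = z k"
    and z: "\<And>j k. z j = z k \<Longrightarrow> dist (x j) (x k) < \<epsilon>"
    using assms[of \<epsilon>] unfolding periodic_path_def by blast
  have "x j \<in> (\<Union>k\<in>{m..<m + int p}. ball (x k) \<epsilon>)" for m j
  proof -
    \<comment> \<open>The representative of \<open>j\<close> modulo \<open>p\<close> in the window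
      starting at \<open>m\<close>.\<close>
    define k where "k = m + (j - m) mod int p"
    have "j = k + (j - m) div int p * int p"
      using div_mult_mod_eq[of "j - m" "int p"] by (simp add: k_def)
    then have "z k = z j"
      using periodic_path_shift[of z "int p" k] p(2) by metis
    moreover have "k \<in> {m..<m + int p}"
      using p(1) by (simp add: k_def)
    ultimately show ?thesis using z by (intro UN_I[of k]) auto
  qed
  then show "\<exists>p::nat. p > 0 \<and> (\<forall>m. range x \<subseteq> (\<Union>k\<in>{m..<m + int p}. ball (x k) \<epsilon>))"
    using p(1) by (intro exI[of _ p]) auto
qed

theorem theorem2:
  fixes M :: "'a::metric_space set"
    and A :: "('a, 'e::euclidean_space) chart set"
    and g :: "('a, 'e) metric_tensor"
    and f f' :: "'a \<Rightarrow> 'a"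
    and V :: "nat \<Rightarrow> 'v set"
    and cell :: "nat \<Rightarrow> 'v \<Rightarrow> 'a set"
    and s :: "nat \<Rightarrow> 'v \<Rightarrow> 'v"
    and \<omega> :: "nat \<Rightarrow> int \<Rightarrow> 'v"
  assumes manifold: "compact_riemannian_manifold M A g"
    and homeo: "homeomorphism M M f f'"
    and coverings: "\<And>t. covering TYPE('e) M (V t) (cell t)"
    and subdivisions: "\<And>t. subdivides (s t) (V (Suc t)) (cell (Suc t)) (V t) (cell t)"
    and diameters: "(\<lambda>t. covering_diameter (V t) (cell t)) \<longlonglongrightarrow> 0"
    and paths: "\<And>t. admissible_path (symbolic_image f (V t) (cell t)) (\<omega> t)"
    and consistent: "consistent_paths s \<omega>"
  shows "(\<exists>!x. trajectory M f x \<and> (\<forall>t k. x k \<in> cell t (\<omega> t k))) \<and>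
    (\<forall>x. trajectory M f x \<and> (\<forall>t k. x k \<in> cell t (\<omega> t k)) \<longrightarrow>
      (\<forall>y. (\<forall>t k. y t k \<in> cell t (\<omega> t k)) \<longrightarrow> (\<forall>k. (\<lambda>t. y t k) \<longlonglongrightarrow> x k)) \<and>
      ((\<forall>t. periodic_path (\<omega> t)) \<longrightarrow> recurrent x))"
proof -
  define S where "S k t = cell t (\<omega> t k)" for k t
  have M: "compact M"
    using manifold by (simp add: compact_riemannian_manifold_def)
  have \<omega>_in: "\<omega> t k \<in> V t" for t k
    using paths[of t] by (simp add: admissible_path_def symbolic_image_def)
  have compact_S: "compact (S k t)" for k t
    unfolding S_def by (rule covering_cell_compact[OF coverings M \<omega>_in])
  have S_sub: "S k t \<subseteq> M" for k t
    unfolding S_def by (rule covering_cell_subset[OF coverings \<omega>_in])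
  have S_ne: "S k t \<noteq> {}" for k t
    using coverings[of t] \<omega>_in[of t k] by (auto simp: S_def covering_def)
  \<comment> \<open>Consistency names the parent of each cell on the path, so subdivision becomes
    nesting along \<open>t\<close> for fixed \<open>k\<close>.\<close>
  have "s t (\<omega> (Suc t) k) = \<omega> t k" for t k
    using consistent unfolding consistent_paths_def by (metis comp_apply)
  then have "S k (Suc t) \<subseteq> S k t" for k t
    using subdivides_cell_subset[OF subdivisions \<omega>_in, of t k] by (simp add: S_def)
  then have S_nested: "S k n \<subseteq> S k m" if "m \<le> n" for k m n
    using that by (rule lift_Suc_antimono_le)
  have diam_S: "diameter (S k t) \<le> covering_diameter (V t) (cell t)" for k t
    unfolding S_def by (rule diameter_le_covering_diameter[OF coverings \<omega>_in])
  have lim: "y \<longlonglongrightarrow> x" if "\<And>t. y t \<in> S k t" "\<And>t. x \<in> S k t" for y x k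
    using tendsto_of_mem_diameter_tendsto_zero[OF compact_imp_bounded[OF compact_S] that diam_S diameters] .
  have "\<exists>x. \<forall>t. x \<in> S k t" for k
    using nested_compact_nonempty[of "S k"] compact_S S_ne S_nested by metis
  then obtain x where x: "\<And>k t. x k \<in> S k t"
    by metis
  have "f (x k) = x (k + 1)" for k
  proof -
    have "\<exists>a. a \<in> S k t \<and> f a \<in> S (k + 1) t" for t
      using admissible_path_symbolic_image_arcE[OF paths[of t], of k] unfolding S_def by blast
    then obtain a where a: "\<And>t. a t \<in> S k t" "\<And>t. f (a t) \<in> S (k + 1) t"
      by metis
    \<comment> \<open>\<open>f\<close> is known to be continuous only on \<open>M\<close>, so the
      points \<open>a t\<close> and their limit must be placed in \<open>M\<close>.\<close>
    have "(\<lambda>t. f (a t)) \<longlonglongrightarrow> f (x k)"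
      using continuous_on_tendsto_compose[OF homeomorphism_cont1[OF homeo] lim[OF a(1) x]]
        x a(1) S_sub by (meson eventually_sequentiallyI subsetD)
    moreover have "(\<lambda>t. f (a t)) \<longlonglongrightarrow> x (k + 1)"
      by (rule lim[OF a(2) x])
    ultimately show ?thesis
      by (rule LIMSEQ_unique)
  qed
  then have traj: "trajectory M f x"
    using x S_sub unfolding trajectory_def by blast
  have unique: "x' = x" if "\<And>t k. x' k \<in> S k t" for x'
  proof
    fix k
    \<comment> \<open>The constant sequence is itself a choice of points in the nested
      cells.\<close>
    have "(\<lambda>_::nat. x' k) \<longlonglongrightarrow> x k"
      by (rule lim[OF that x])
    then show "x' k = x k"
      by (simp add: LIMSEQ_const_iff)
  qed
  have recurrent: "recurrent x" if "\<forall>t. periodic_path (\<omega> t)"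
  proof (rule recurrent_if_periodic_cells)
    fix \<epsilon> :: real assume "\<epsilon> > 0"
    then obtain t where t: "covering_diameter (V t) (cell t) < \<epsilon>"
      using order_tendstoD(2)[OF diameters] eventually_happens' sequentially_bot by blast
    \<comment> \<open>The path at this fine level \<open>t\<close> serves as the labelling: equal
      labels put both points into one cell of diameter below \<epsilon>.\<close>
    have "dist (x j) (x k) < \<epsilon>" if "\<omega> t j = \<omega> t k" for j k
    proof -
      have "x j \<in> S k t"
        using x[of j t] that by (simp add: S_def)
      then show ?thesis
        using diameter_bounded_bound[OF compact_imp_bounded[OF compact_S] _ x] diam_S[of k t] t
        by fastforce
    qed
    then show "\<exists>z::int \<Rightarrow> 'v. periodic_path z \<and> (\<forall>j k. z j = z k \<longrightarrow> dist (x j) (x k) < \<epsilon>)"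
      using that by blast
  qed
  show ?thesis
    unfolding S_def[symmetric]
  proof (intro conjI allI impI)
    show "\<exists>!x. trajectory M f x \<and> (\<forall>t k. x k \<in> S k t)"
      using traj x unique by (intro ex1I[of _ x]) simp_all
  next
    fix x' y k assume "trajectory M f x' \<and> (\<forall>t k. x' k \<in> S k t)" "\<forall>t k. y t k \<in> S k t"
    then show "(\<lambda>t. y t k) \<longlonglongrightarrow> x' k"
      by (intro lim[of _ k]) simp_all
  next
    \<comment> \<open>Uniqueness identifies \<open>x'\<close> with the constructed \<open>x\<close>,
      so recurrence carries over.\<close>
    fix x' assume "trajectory M f x' \<and> (\<forall>t k. x' k \<in> S k t)" "\<forall>t. periodic_path (\<omega> t)"
    then show "recurrent x'"
      using unique[of x'] recurrent by simp
  qed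
qed

end
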